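(* For every energy value $h\in\mathbb{R}$, the system $$\frac{dr}{d\zeta}=\frac{1}{\sqrt\pi}\frac{r^3}{r^2+2}\,\hat E(h,r,\alpha)\cos(\psi-\alpha),\qquad \frac{d\alpha}{d\zeta}=\frac{1}{\sqrt\pi}\hat E(h,r,\alpha)\sin(\psi-\alpha),$$ $$\frac{d\psi}{d\zeta}=-\frac{r^2}{\sqrt\pi}\left[\frac{2\cos(\psi+\alpha)}{\sin 2\alpha}-\sin(\psi-\alpha)\right]$$ admits no unbounded collisionless orbit.
   Context: This system describes, in McGehee-type coordinates $(r,\alpha,\psi)$ with $r\ge 0$, $\alpha\in(0,\pi/2)$, $\psi\in\mathbb{R}/2\pi\mathbb{Z}$, four points $(\pm q_1,\pm q_2)$ in the plane (an orbit of the Klein group $D_2$) interacting by a logarithmic potential with total energy $h$; $q_1=re^{-1/r^2}\cos\alpha$, $q_2=re^{-1/r^2}\sin\alpha$. Here $$\hat E(h,r,\alpha)=2\left[h r^2+3(1-r^2\log r)\right]-2r^2\log(4\sin 2\alpha),$$ extended to $r=0$ by $\hat E=6$. Motion takes place only in the region $\hat E(h,r,\alpha)\ge 0$, which is the phase space considered. A solution $\zeta\mapsto(r(\zeta),\alpha(\zeta),\psi(\zeta))$ is called unbounded if $\lim_{\zeta\to+\infty}r(\zeta)=+\infty$. A binary collision occurs when a solution with $r>0$ reaches one of the planes $\alpha=0$ or $\alpha=\pi/2$. A solution is collisionless if it never undergoes a binary collision, i.e. $\alpha(\zeta)\in(0,\pi/2)$ throughout, and never reaches $r=0$. *)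

theory Defs
  imports "HOL-Analysis.Analysis"
begin

definition E_hat :: "real \<Rightarrow> real \<Rightarrow> real \<Rightarrow> real" where
  "E_hat h r \<alpha> =
     (if r = 0 then 6
      else 2 * (h * r\<^sup>2 + 3 * (1 - r\<^sup>2 * ln r)) - 2 * r\<^sup>2 * ln (4 * sin (2 * \<alpha>)))"

definition r_field :: "real \<Rightarrow> real \<Rightarrow> real \<Rightarrow> real \<Rightarrow> real" where
  "r_field h r \<alpha> \<psi> = 1 / sqrt pi * (r ^ 3 / (r\<^sup>2 + 2)) * E_hat h r \<alpha> * cos (\<psi> - \<alpha>)"

definition \<alpha>_field :: "real \<Rightarrow> real \<Rightarrow> real \<Rightarrow> real \<Rightarrow> real" where
  "\<alpha>_field h r \<alpha> \<psi> = 1 / sqrt pi * E_hat h r \<alpha> * sin (\<psi> - \<alpha>)"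

definition \<psi>_field :: "real \<Rightarrow> real \<Rightarrow> real \<Rightarrow> real" where
  "\<psi>_field r \<alpha> \<psi> =
     - (r\<^sup>2 / sqrt pi) * (2 * cos (\<psi> + \<alpha>) / sin (2 * \<alpha>) - sin (\<psi> - \<alpha>))"

text \<open>The angle \<open>\<psi>\<close> is represented by a real number instead of a class modulo \<open>2\<pi>\<close>: the
  vector field is \<open>2\<pi>\<close>-periodic in \<open>\<psi>\<close>, and every differentiable curve in the circle defined on
  an interval lifts to the real line.\<close>

definition phase_space :: "real \<Rightarrow> (real \<times> real \<times> real) set" where
  "phase_space h = {(r, \<alpha>, \<psi>). 0 \<le> r \<and> \<alpha> \<in> {0<..<pi/2} \<and> 0 \<le> E_hat h r \<alpha>}"

text \<open>Solutions are not required to be maximal: \<open>I\<close> is any interval of time. At an endpoint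
  belonging to \<open>I\<close> the derivatives are one-sided.\<close>

definition is_solution ::
  "real \<Rightarrow> real set \<Rightarrow> (real \<Rightarrow> real) \<Rightarrow> (real \<Rightarrow> real) \<Rightarrow> (real \<Rightarrow> real) \<Rightarrow> bool" where
  "is_solution h I r \<alpha> \<psi> \<longleftrightarrow>
     is_interval I \<and>
     (\<forall>\<zeta>\<in>I.
        (r \<zeta>, \<alpha> \<zeta>, \<psi> \<zeta>) \<in> phase_space h \<and>
        (r has_real_derivative r_field h (r \<zeta>) (\<alpha> \<zeta>) (\<psi> \<zeta>)) (at \<zeta> within I) \<and>
        (\<alpha> has_real_derivative \<alpha>_field h (r \<zeta>) (\<alpha> \<zeta>) (\<psi> \<zeta>)) (at \<zeta> within I) \<and>
        (\<psi> has_real_derivative \<psi>_field (r \<zeta>) (\<alpha> \<zeta>) (\<psi> \<zeta>)) (at \<zeta> within I))"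

text \<open>The first conjunct is needed because \<open>r\<close> is a total function, whose values outside the
  interval of definition \<open>I\<close> are meaningless.\<close>

definition unbounded_solution :: "real set \<Rightarrow> (real \<Rightarrow> real) \<Rightarrow> bool" where
  "unbounded_solution I r \<longleftrightarrow> (\<exists>a. {a..} \<subseteq> I) \<and> filterlim r at_top at_top"

text \<open>The planes \<open>\<alpha> = 0\<close> and \<open>\<alpha> = \<pi>/2\<close> are the binary collisions, \<open>r = 0\<close> is the total
  collapse. The condition on \<open>\<alpha>\<close> already holds for every curve in the phase space, since the
  vector field is singular on these two planes: a solution running into a binary collision at a
  finite time \<open>b\<close> is defined only up to \<open>b\<close>.\<close>

definition collisionless :: "real set \<Rightarrow> (real \<Rightarrow> real) \<Rightarrow> (real \<Rightarrow> real) \<Rightarrow> bool" where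
  "collisionless I r \<alpha> \<longleftrightarrow> (\<forall>\<zeta>\<in>I. \<alpha> \<zeta> \<in> {0<..<pi/2} \<and> 0 < r \<zeta>)"

end

theory Submission
  imports Defs
begin

text \<open>
  Put \<open>\<rho> = r exp (- 1 / r\<^sup>2)\<close> and let \<open>q\<^sub>1 = \<rho> cos \<alpha>\<close>, \<open>q\<^sub>2 = \<rho> sin \<alpha>\<close> be the Cartesian
  coordinates of the point in the open first quadrant. The function \<open>K = E_hat / r\<^sup>2\<close> equals
  \<open>2 h - 2 ln (8 q\<^sub>1 q\<^sub>2 \<rho>)\<close>; it is, up to normalisation, the kinetic energy. With the velocity
  \<open>p = \<surd>K (cos \<psi>, sin \<psi>)\<close> and the nonnegative time change \<open>s = \<rho> r\<^sup>2 \<surd>K / \<surd>\<pi>\<close> the system reads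
  \<open>q\<^sub>i' = s p\<^sub>i\<close>, \<open>p\<^sub>i' = - s (1 / q\<^sub>i + q\<^sub>i / \<rho>\<^sup>2)\<close>. The force is attractive in each coordinate,
  hence both components of \<open>p\<close> decrease.

  Suppose that \<open>r\<close>, and hence \<open>\<rho>\<close>, tends to infinity. If both components of \<open>p\<close> stay
  nonnegative, then \<open>q\<^sub>1\<close> and \<open>q\<^sub>2\<close> are nondecreasing, so \<open>q\<^sub>1 q\<^sub>2\<close> stays away from \<open>0\<close>, and
  the inequality \<open>8 q\<^sub>1 q\<^sub>2 \<rho> \<le> exp h\<close>, which expresses \<open>K \<ge> 0\<close>, bounds \<open>\<rho>\<close>. Otherwise one
  component, say \<open>p\<^sub>2\<close>, is at most \<open>-c < 0\<close> from some time on, while \<open>p\<^sub>1\<close> is at most some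
  \<open>U \<ge> 0\<close>. Then \<open>c q\<^sub>1 + U q\<^sub>2\<close> and \<open>q\<^sub>2\<close> do not increase, and since both coordinates are positive,
  \<open>\<rho>\<close> is bounded again. (In physical time: \<open>q\<^sub>2\<close> would vanish in a finite time, during which
  \<open>q\<^sub>1\<close> cannot escape.)

  Differentiating \<open>\<surd>K\<close> requires \<open>K > 0\<close>. Since \<open>K\<close> solves a linear homogeneous equation, it stays
  positive once it is positive; and if it vanished throughout, \<open>r\<close> would be constant.
\<close>

section \<open>Plane curves with decreasing velocity\<close>

lemma nonincreasing_from:
  fixes f f' :: "real \<Rightarrow> real"
  assumes "\<And>t. t \<ge> a \<Longrightarrow> (f has_real_derivative f' t) (at t)"
    and "\<And>t. t \<ge> a \<Longrightarrow> f' t \<le> 0"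
    and "a \<le> t" "t \<le> u"
  shows "f u \<le> f t"
  using assms by (intro DERIV_nonpos_imp_nonincreasing[of t u f]) (auto intro: order_trans)

lemma nondecreasing_from:
  fixes f f' :: "real \<Rightarrow> real"
  assumes "\<And>t. t \<ge> a \<Longrightarrow> (f has_real_derivative f' t) (at t)"
    and "\<And>t. t \<ge> a \<Longrightarrow> f' t \<ge> 0"
    and "a \<le> t" "t \<le> u"
  shows "f t \<le> f u"
  using assms by (intro DERIV_nonneg_imp_nondecreasing[of t u f]) (auto intro: order_trans)

lemma linear_ode_stays_positive:
  fixes f g :: "real \<Rightarrow> real"
  assumes f': "\<And>t. t \<ge> a \<Longrightarrow> (f has_real_derivative g t * f t) (at t)"
    and g: "continuous_on {a..} g"
    and nonneg: "\<And>t. t \<ge> a \<Longrightarrow> f t \<ge> 0"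
    and pos: "f a > 0" and "a \<le> b"
  shows "f b > 0"
proof -
  have "continuous_on {a..b} g"
    using g by (rule continuous_on_subset) auto
  then have "bounded (g ` {a..b})"
    by (intro compact_imp_bounded compact_continuous_image) auto
  then obtain M where "\<forall>y\<in>g ` {a..b}. norm y \<le> M"
    unfolding bounded_iff by blast
  then have M: "\<bar>g t\<bar> \<le> M" if "t \<in> {a..b}" for t
    using that by auto
  \<comment> \<open>As \<open>f\<close> is nonnegative and \<open>g + M \<ge> 0\<close> on \<open>{a..b}\<close>, the factor \<open>exp (M t)\<close> makes it monotone.\<close>
  have "f a * exp (M * a) \<le> f b * exp (M * b)"
  proof (rule DERIV_nonneg_imp_nondecreasing[OF \<open>a \<le> b\<close>])
    fix t assume t: "a \<le> t" "t \<le> b"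
    have "((\<lambda>t. f t * exp (M * t)) has_real_derivative (g t + M) * f t * exp (M * t)) (at t)"
      using t by (auto intro!: derivative_eq_intros f' simp: algebra_simps)
    moreover have "(g t + M) * f t * exp (M * t) \<ge> 0"
      using M[of t] nonneg[of t] t by (intro mult_nonneg_nonneg) auto
    ultimately show "\<exists>y. ((\<lambda>t. f t * exp (M * t)) has_real_derivative y) (at t) \<and> 0 \<le> y"
      by blast
  qed
  moreover have "f a * exp (M * a) > 0"
    using pos by simp
  ultimately have "f b * exp (M * b) > 0"
    by linarith
  then show ?thesis
    by (simp add: zero_less_mult_iff)
qed

lemma bounded_if_component_moves_inward:
  fixes x y u v s :: "real \<Rightarrow> real"
  assumes x': "\<And>t. t \<ge> a \<Longrightarrow> (x has_real_derivative s t * u t) (at t)"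
    and y': "\<And>t. t \<ge> a \<Longrightarrow> (y has_real_derivative s t * v t) (at t)"
    and s: "\<And>t. t \<ge> a \<Longrightarrow> s t \<ge> 0"
    and x: "\<And>t. t \<ge> a \<Longrightarrow> x t \<ge> 0" and y: "\<And>t. t \<ge> a \<Longrightarrow> y t \<ge> 0"
    and u: "\<And>t. t \<ge> a \<Longrightarrow> u t \<le> u a" and v: "\<And>t. t \<ge> a \<Longrightarrow> v t \<le> v a"
    and va: "v a < 0"
  shows "\<exists>B. \<forall>t\<ge>a. x t + y t \<le> B"
proof -
  define c where "c = - v a"
  define U where "U = max 0 (u a)"
  have c: "c > 0" and U: "U \<ge> 0"
    using va by (auto simp: c_def U_def)
  \<comment> \<open>The weights are chosen so that the velocity \<open>u \<le> U\<close> of \<open>x\<close> is compensated by the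
     velocity \<open>v \<le> -c\<close> of \<open>y\<close>.\<close>
  have "c * x t + U * y t \<le> c * x a + U * y a" if "t \<ge> a" for t
  proof (rule nonincreasing_from[where a = a and
        f = "\<lambda>t. c * x t + U * y t" and f' = "\<lambda>t. s t * (c * u t + U * v t)"])
    fix t assume t: "t \<ge> a"
    show "((\<lambda>t. c * x t + U * y t) has_real_derivative s t * (c * u t + U * v t)) (at t)"
      using t by (auto intro!: derivative_eq_intros x' y' simp: algebra_simps)
    have "c * u t \<le> c * U"
      using u[OF t] c by (intro mult_left_mono) (auto simp: U_def)
    moreover have "U * v t \<le> U * (- c)"
      using v[OF t] U by (intro mult_left_mono) (auto simp: c_def)
    ultimately have "c * u t + U * v t \<le> 0"
      by (simp add: algebra_simps)
    then show "s t * (c * u t + U * v t) \<le> 0"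
      using s[OF t] by (simp add: mult_nonneg_nonpos)
  qed (use that in auto)
  moreover have "U * y t \<ge> 0" if "t \<ge> a" for t
    using U y[OF that] by simp
  ultimately have cx: "c * x t \<le> c * x a + U * y a" if "t \<ge> a" for t
    using that by (meson add_increasing2 order_trans le_add_same_cancel1)
  have "x t \<le> (c * x a + U * y a) / c" if "t \<ge> a" for t
    using cx[OF that] c by (simp add: pos_le_divide_eq mult.commute)
  moreover have "y t \<le> y a" if "t \<ge> a" for t
  proof (rule nonincreasing_from[where a = a, OF y'])
    show "s t * v t \<le> 0" if "t \<ge> a" for t
      using s[OF that] v[OF that] va by (simp add: mult_nonneg_nonpos)
  qed (use that in auto)
  ultimately show ?thesis
    by (intro exI[of _ "(c * x a + U * y a) / c + y a"]) (auto intro: add_mono)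
qed

text \<open>A curve in the open first quadrant whose velocity, up to a nonnegative time change \<open>s\<close>,
  decreases in both components either is bounded from some time on or stays away from the axes.\<close>

lemma bounded_or_away_from_axes:
  fixes x y u v s :: "real \<Rightarrow> real"
  assumes x': "\<And>t. t \<ge> a \<Longrightarrow> (x has_real_derivative s t * u t) (at t)"
    and y': "\<And>t. t \<ge> a \<Longrightarrow> (y has_real_derivative s t * v t) (at t)"
    and s: "\<And>t. t \<ge> a \<Longrightarrow> s t \<ge> 0"
    and x: "\<And>t. t \<ge> a \<Longrightarrow> x t > 0" and y: "\<And>t. t \<ge> a \<Longrightarrow> y t > 0"
    and u: "\<And>t t'. a \<le> t \<Longrightarrow> t \<le> t' \<Longrightarrow> u t' \<le> u t"
    and v: "\<And>t t'. a \<le> t \<Longrightarrow> t \<le> t' \<Longrightarrow> v t' \<le> v t"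
  shows "(\<exists>b\<ge>a. \<exists>B. \<forall>t\<ge>b. x t + y t \<le> B) \<or> (\<exists>m>0. \<forall>t\<ge>a. m \<le> x t * y t)"
proof -
  have x0: "x t \<ge> 0" and y0: "y t \<ge> 0" if "t \<ge> a" for t
    using x[OF that] y[OF that] by auto
  consider (y_in) b where "b \<ge> a" "v b < 0" | (x_in) b where "b \<ge> a" "u b < 0"
    | (out) "\<And>t. t \<ge> a \<Longrightarrow> u t \<ge> 0" "\<And>t. t \<ge> a \<Longrightarrow> v t \<ge> 0"
    by (meson not_le)
  then show ?thesis
  proof cases
    case y_in
    have "\<exists>B. \<forall>t\<ge>b. x t + y t \<le> B"
      by (rule bounded_if_component_moves_inward[where s = s and u = u and v = v])
        (use y_in x' y' s u v in \<open>auto intro: x0 y0\<close>)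
    then show ?thesis
      using y_in by blast
  next
    case x_in
    have "\<exists>B. \<forall>t\<ge>b. y t + x t \<le> B"
      by (rule bounded_if_component_moves_inward[where s = s and u = v and v = u])
        (use x_in x' y' s u v in \<open>auto intro: x0 y0\<close>)
    then show ?thesis
      using x_in by (metis add.commute)
  next
    case out
    have "x a \<le> x t" if "t \<ge> a" for t
      by (rule nondecreasing_from[where a = a, OF x']) (use that s out in auto)
    moreover have "y a \<le> y t" if "t \<ge> a" for t
      by (rule nondecreasing_from[where a = a, OF y']) (use that s out in auto)
    ultimately have "\<forall>t\<ge>a. x a * y a \<le> x t * y t"
      using x0 y0 by (auto intro!: mult_mono)
    then show ?thesis
      using x[of a] y[of a] by (auto intro!: exI[of _ "x a * y a"])
  qed
qed

section \<open>The system in Cartesian coordinates\<close>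

text \<open>A solution on the half-line \<open>{a..}\<close> that meets no collision; \<open>a\<close> is taken interior to
  the interval of definition, so that all derivatives are two-sided.\<close>

locale collisionless_orbit =
  fixes h :: real and r \<alpha> \<psi> :: "real \<Rightarrow> real" and a :: real
  assumes r_pos: "t \<ge> a \<Longrightarrow> r t > 0"
    and \<alpha>_gt: "t \<ge> a \<Longrightarrow> \<alpha> t > 0" and \<alpha>_lt: "t \<ge> a \<Longrightarrow> \<alpha> t < pi / 2"
    and E_nonneg: "t \<ge> a \<Longrightarrow> E_hat h (r t) (\<alpha> t) \<ge> 0"
    and r_deriv: "t \<ge> a \<Longrightarrow> (r has_real_derivative r_field h (r t) (\<alpha> t) (\<psi> t)) (at t)"
    and \<alpha>_deriv: "t \<ge> a \<Longrightarrow> (\<alpha> has_real_derivative \<alpha>_field h (r t) (\<alpha> t) (\<psi> t)) (at t)"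
    and \<psi>_deriv: "t \<ge> a \<Longrightarrow> (\<psi> has_real_derivative \<psi>_field (r t) (\<alpha> t) (\<psi> t)) (at t)"
begin

text \<open>The distance of the point from the origin.\<close>

definition \<rho> :: "real \<Rightarrow> real"
  where "\<rho> t = r t * exp (- 1 / (r t)\<^sup>2)"

text \<open>The kinetic energy, up to normalisation: it is \<open>E_hat / r\<^sup>2\<close>.\<close>

definition K :: "real \<Rightarrow> real"
  where "K t = 2 * h + 6 / (r t)\<^sup>2 - 6 * ln (r t) - 2 * ln (4 * sin (2 * \<alpha> t))"

text \<open>The logarithmic derivative of \<^term>\<open>K\<close>.\<close>

definition K_rate :: "real \<Rightarrow> real"
  where "K_rate t = - ((r t)\<^sup>2 / sqrt pi) *
    (6 * cos (\<psi> t - \<alpha> t) + 4 * cos (2 * \<alpha> t) / sin (2 * \<alpha> t) * sin (\<psi> t - \<alpha> t))"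

text \<open>The derivative of the time of the Newtonian equations with respect to the independent
  variable of the system.\<close>

definition time_rate :: "real \<Rightarrow> real"
  where "time_rate t = \<rho> t * (r t)\<^sup>2 * sqrt (K t) / sqrt pi"

lemma sin_pos: "t \<ge> a \<Longrightarrow> sin (\<alpha> t) > 0" and cos_pos: "t \<ge> a \<Longrightarrow> cos (\<alpha> t) > 0"
  using \<alpha>_gt[of t] \<alpha>_lt[of t] by (auto intro: sin_gt_zero cos_gt_zero)

lemma sin_double_pos: "t \<ge> a \<Longrightarrow> sin (2 * \<alpha> t) > 0"
  using sin_pos[of t] cos_pos[of t] by (simp add: sin_double)

lemma \<rho>_pos: "t \<ge> a \<Longrightarrow> \<rho> t > 0"
  using r_pos[of t] by (simp add: \<rho>_def)

lemma E_eq_K: "t \<ge> a \<Longrightarrow> E_hat h (r t) (\<alpha> t) = (r t)\<^sup>2 * K t"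
  using r_pos[of t] by (simp add: K_def E_hat_def field_simps power2_eq_square)

lemma K_nonneg: "t \<ge> a \<Longrightarrow> K t \<ge> 0"
  using E_nonneg[of t] E_eq_K[of t] r_pos[of t] by (simp add: zero_le_mult_iff)

lemma time_rate_nonneg: "t \<ge> a \<Longrightarrow> time_rate t \<ge> 0"
  using \<rho>_pos[of t] K_nonneg[of t] by (simp add: time_rate_def)

lemma r_deriv_K: "t \<ge> a \<Longrightarrow> (r has_real_derivative
    (r t) ^ 5 / ((r t)\<^sup>2 + 2) * K t * cos (\<psi> t - \<alpha> t) / sqrt pi) (at t)"
  using r_deriv[of t] E_eq_K[of t]
  by (simp add: r_field_def eval_nat_numeral mult_ac)

lemma \<alpha>_deriv_K: "t \<ge> a \<Longrightarrow> (\<alpha> has_real_derivative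
    (r t)\<^sup>2 * K t * sin (\<psi> t - \<alpha> t) / sqrt pi) (at t)"
  using \<alpha>_deriv[of t] E_eq_K[of t] by (simp add: \<alpha>_field_def mult_ac)

lemma K_deriv:
  assumes t: "t \<ge> a"
  shows "(K has_real_derivative K_rate t * K t) (at t)"
proof -
  let ?r' = "(r t) ^ 5 / ((r t)\<^sup>2 + 2) * K t * cos (\<psi> t - \<alpha> t) / sqrt pi"
  let ?\<alpha>' = "(r t)\<^sup>2 * K t * sin (\<psi> t - \<alpha> t) / sqrt pi"
  have R: "r t > 0" and S: "sin (2 * \<alpha> t) > 0"
    using r_pos sin_double_pos t by auto
  have "(K has_real_derivative
      - 6 * ((r t)\<^sup>2 + 2) / (r t) ^ 3 * r' - 4 * cos (2 * \<alpha> t) / sin (2 * \<alpha> t) * \<alpha>') (at t)"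
    if "(r has_real_derivative r') (at t)" "(\<alpha> has_real_derivative \<alpha>') (at t)" for r' \<alpha>'
    unfolding K_def[abs_def] using R S
    by (auto intro!: derivative_eq_intros that)
       (simp add: divide_simps eval_nat_numeral, simp add: algebra_simps)
  from this[OF r_deriv_K[OF t] \<alpha>_deriv_K[OF t]]
  have "(K has_real_derivative
      - 6 * ((r t)\<^sup>2 + 2) / (r t) ^ 3 * ?r' - 4 * cos (2 * \<alpha> t) / sin (2 * \<alpha> t) * ?\<alpha>') (at t)" .
  also have "- 6 * ((r t)\<^sup>2 + 2) / (r t) ^ 3 * ?r'
      = - ((r t)\<^sup>2 / sqrt pi) * (6 * cos (\<psi> t - \<alpha> t)) * K t"
  proof -
    have "(r t)\<^sup>2 + 2 \<noteq> 0"
      by (smt (verit) zero_le_power2)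
    then show ?thesis
      using R by (simp add: divide_simps) (simp add: eval_nat_numeral algebra_simps)
  qed
  finally show ?thesis
    by (simp add: K_rate_def algebra_simps)
qed

lemma \<rho>_deriv:
  assumes t: "t \<ge> a"
  shows "(\<rho> has_real_derivative \<rho> t * (r t)\<^sup>2 * K t * cos (\<psi> t - \<alpha> t) / sqrt pi) (at t)"
proof -
  let ?r' = "(r t) ^ 5 / ((r t)\<^sup>2 + 2) * K t * cos (\<psi> t - \<alpha> t) / sqrt pi"
  have R: "r t > 0"
    using r_pos t by auto
  have "(\<rho> has_real_derivative exp (- 1 / (r t)\<^sup>2) * (((r t)\<^sup>2 + 2) / (r t)\<^sup>2) * r') (at t)"
    if "(r has_real_derivative r') (at t)" for r'
    unfolding \<rho>_def[abs_def] using R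
    by (auto intro!: derivative_eq_intros that)
       (simp add: divide_simps eval_nat_numeral, simp add: algebra_simps)
  from this[OF r_deriv_K[OF t]]
  have "(\<rho> has_real_derivative exp (- 1 / (r t)\<^sup>2) * (((r t)\<^sup>2 + 2) / (r t)\<^sup>2) * ?r') (at t)" .
  also have "exp (- 1 / (r t)\<^sup>2) * (((r t)\<^sup>2 + 2) / (r t)\<^sup>2) * ?r'
      = \<rho> t * (r t)\<^sup>2 * K t * cos (\<psi> t - \<alpha> t) / sqrt pi"
  proof -
    have "(r t)\<^sup>2 + 2 \<noteq> 0"
      by (smt (verit) zero_le_power2)
    then show ?thesis
      using R by (simp add: divide_simps \<rho>_def) (simp add: eval_nat_numeral)
  qed
  finally show ?thesis .
qed

lemma q1_deriv:
  assumes t: "t \<ge> a"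
  shows "((\<lambda>t. \<rho> t * cos (\<alpha> t)) has_real_derivative
    time_rate t * (sqrt (K t) * cos (\<psi> t))) (at t)"
proof -
  have "((\<lambda>t. \<rho> t * cos (\<alpha> t)) has_real_derivative \<rho> t * (r t)\<^sup>2 * K t / sqrt pi *
      (cos (\<psi> t - \<alpha> t) * cos (\<alpha> t) - sin (\<psi> t - \<alpha> t) * sin (\<alpha> t))) (at t)"
    by (auto intro!: derivative_eq_intros \<rho>_deriv[OF t] \<alpha>_deriv_K[OF t] simp: field_simps)
  also have "cos (\<psi> t - \<alpha> t) * cos (\<alpha> t) - sin (\<psi> t - \<alpha> t) * sin (\<alpha> t) = cos (\<psi> t)"
    by (simp flip: cos_add)
  also have "\<rho> t * (r t)\<^sup>2 * K t / sqrt pi * cos (\<psi> t) = time_rate t * (sqrt (K t) * cos (\<psi> t))"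
    using K_nonneg[OF t] by (simp add: time_rate_def)
  finally show ?thesis .
qed

lemma q2_deriv:
  assumes t: "t \<ge> a"
  shows "((\<lambda>t. \<rho> t * sin (\<alpha> t)) has_real_derivative
    time_rate t * (sqrt (K t) * sin (\<psi> t))) (at t)"
proof -
  have "((\<lambda>t. \<rho> t * sin (\<alpha> t)) has_real_derivative \<rho> t * (r t)\<^sup>2 * K t / sqrt pi *
      (sin (\<psi> t - \<alpha> t) * cos (\<alpha> t) + cos (\<psi> t - \<alpha> t) * sin (\<alpha> t))) (at t)"
    by (auto intro!: derivative_eq_intros \<rho>_deriv[OF t] \<alpha>_deriv_K[OF t] simp: field_simps)
  also have "sin (\<psi> t - \<alpha> t) * cos (\<alpha> t) + cos (\<psi> t - \<alpha> t) * sin (\<alpha> t) = sin (\<psi> t)"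
    by (simp flip: sin_add)
  also have "\<rho> t * (r t)\<^sup>2 * K t / sqrt pi * sin (\<psi> t) = time_rate t * (sqrt (K t) * sin (\<psi> t))"
    using K_nonneg[OF t] by (simp add: time_rate_def)
  finally show ?thesis .
qed

lemma sqrt_K_deriv:
  assumes t: "t \<ge> a" and "K t > 0"
  shows "((\<lambda>t. sqrt (K t)) has_real_derivative K_rate t / 2 * sqrt (K t)) (at t)"
proof -
  have "K t / sqrt (K t) = sqrt (K t)"
    using assms by (simp add: real_div_sqrt)
  moreover have "((\<lambda>t. sqrt (K t)) has_real_derivative K_rate t * (K t / sqrt (K t)) / 2) (at t)"
    using assms by (auto intro!: derivative_eq_intros K_deriv simp: field_simps)
  ultimately show ?thesis
    by simp
qed

text \<open>Let \<open>q\<^sub>1 = \<rho> cos \<alpha>\<close> and \<open>q\<^sub>2 = \<rho> sin \<alpha>\<close>. Up to the factor \<open>r\<^sup>2 \<surd>K / \<surd>\<pi>\<close>, the next two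
  derivatives are the components of the force: those of the gradient of \<open>K / 2 = h - ln (8 q\<^sub>1 q\<^sub>2 \<rho>)\<close>, multiplied by \<open>\<rho>\<close>.\<close>

lemma p1_deriv:
  assumes t: "t \<ge> a" and K: "K t > 0"
  shows "((\<lambda>t. sqrt (K t) * cos (\<psi> t)) has_real_derivative
    - ((r t)\<^sup>2 * sqrt (K t) / sqrt pi) * (cos (\<alpha> t) + 1 / cos (\<alpha> t))) (at t)"
proof -
  let ?T = "\<psi>_field (r t) (\<alpha> t) (\<psi> t)"
  have pos: "sin (\<alpha> t) > 0" "cos (\<alpha> t) > 0"
    using sin_pos cos_pos t by auto
  have "((\<lambda>t. sqrt (K t) * cos (\<psi> t)) has_real_derivative
      sqrt (K t) * (K_rate t / 2 * cos (\<psi> t) - ?T * sin (\<psi> t))) (at t)"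
    by (rule DERIV_cong[OF DERIV_mult[OF sqrt_K_deriv[OF assms] DERIV_fun_cos[OF \<psi>_deriv[OF t]]]])
       (simp add: algebra_simps)
  also have "K_rate t / 2 * cos (\<psi> t) - ?T * sin (\<psi> t)
      = - ((r t)\<^sup>2 / sqrt pi) * (cos (\<alpha> t) + 1 / cos (\<alpha> t))"
  proof -
    have trig: "(3 * cos (\<psi> t - \<alpha> t)
          + 2 * cos (2 * \<alpha> t) / sin (2 * \<alpha> t) * sin (\<psi> t - \<alpha> t)) * cos (\<psi> t)
        - (2 * cos (\<psi> t + \<alpha> t) / sin (2 * \<alpha> t) - sin (\<psi> t - \<alpha> t)) * sin (\<psi> t)
        = cos (\<alpha> t) + 1 / cos (\<alpha> t)"
    proof -
      define A B c s where "A = cos (\<psi> t)" "B = sin (\<psi> t)" "c = cos (\<alpha> t)" "s = sin (\<alpha> t)"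
      note d = this
      have e: "A\<^sup>2 + B\<^sup>2 = 1" "c\<^sup>2 + s\<^sup>2 = 1"
        by (simp_all add: d)
      have "(3 * (A * c + B * s) + 2 * (c\<^sup>2 - s\<^sup>2) / (2 * s * c) * (B * c - A * s)) * A
          - (2 * (A * c - B * s) / (2 * s * c) - (B * c - A * s)) * B = c + 1 / c"
        using pos(1)[folded d] pos(2)[folded d] by (simp add: divide_simps) (use e in algebra)
      then show ?thesis
        by (simp add: cos_diff sin_diff cos_add sin_double cos_double flip: d)
    qed
    show ?thesis
      unfolding K_rate_def \<psi>_field_def trig[symmetric]
      by (simp add: algebra_simps add_divide_distrib diff_divide_distrib)
  qed
  finally show ?thesis
    by (simp add: algebra_simps)
qed

lemma p2_deriv:
  assumes t: "t \<ge> a" and K: "K t > 0"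
  shows "((\<lambda>t. sqrt (K t) * sin (\<psi> t)) has_real_derivative
    - ((r t)\<^sup>2 * sqrt (K t) / sqrt pi) * (sin (\<alpha> t) + 1 / sin (\<alpha> t))) (at t)"
proof -
  let ?T = "\<psi>_field (r t) (\<alpha> t) (\<psi> t)"
  have pos: "sin (\<alpha> t) > 0" "cos (\<alpha> t) > 0"
    using sin_pos cos_pos t by auto
  have "((\<lambda>t. sqrt (K t) * sin (\<psi> t)) has_real_derivative
      sqrt (K t) * (K_rate t / 2 * sin (\<psi> t) + ?T * cos (\<psi> t))) (at t)"
    by (rule DERIV_cong[OF DERIV_mult[OF sqrt_K_deriv[OF assms] DERIV_fun_sin[OF \<psi>_deriv[OF t]]]])
       (simp add: algebra_simps)
  also have "K_rate t / 2 * sin (\<psi> t) + ?T * cos (\<psi> t)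
      = - ((r t)\<^sup>2 / sqrt pi) * (sin (\<alpha> t) + 1 / sin (\<alpha> t))"
  proof -
    have trig: "(3 * cos (\<psi> t - \<alpha> t)
          + 2 * cos (2 * \<alpha> t) / sin (2 * \<alpha> t) * sin (\<psi> t - \<alpha> t)) * sin (\<psi> t)
        + (2 * cos (\<psi> t + \<alpha> t) / sin (2 * \<alpha> t) - sin (\<psi> t - \<alpha> t)) * cos (\<psi> t)
        = sin (\<alpha> t) + 1 / sin (\<alpha> t)"
    proof -
      define A B c s where "A = cos (\<psi> t)" "B = sin (\<psi> t)" "c = cos (\<alpha> t)" "s = sin (\<alpha> t)"
      note d = this
      have e: "A\<^sup>2 + B\<^sup>2 = 1" "c\<^sup>2 + s\<^sup>2 = 1"
        by (simp_all add: d)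
      have "(3 * (A * c + B * s) + 2 * (c\<^sup>2 - s\<^sup>2) / (2 * s * c) * (B * c - A * s)) * B
          + (2 * (A * c - B * s) / (2 * s * c) - (B * c - A * s)) * A = s + 1 / s"
        using pos(1)[folded d] pos(2)[folded d] by (simp add: divide_simps) (use e in algebra)
      then show ?thesis
        by (simp add: cos_diff sin_diff cos_add sin_double cos_double flip: d)
    qed
    show ?thesis
      unfolding K_rate_def \<psi>_field_def trig[symmetric]
      by (simp add: algebra_simps add_divide_distrib diff_divide_distrib)
  qed
  finally show ?thesis
    by (simp add: algebra_simps)
qed

lemma continuous_on_K_rate: "continuous_on {a..} K_rate"
proof -
  have "continuous_on {a..} r" "continuous_on {a..} \<alpha>" "continuous_on {a..} \<psi>"
    by (auto intro!: continuous_at_imp_continuous_on DERIV_isCont r_deriv \<alpha>_deriv \<psi>_deriv)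
  moreover have "sin (2 * \<alpha> t) \<noteq> 0" if "t \<in> {a..}" for t
    using sin_double_pos[of t] that by auto
  ultimately show ?thesis
    unfolding K_rate_def[abs_def] by (auto intro!: continuous_intros)
qed

lemma energy_bound:
  assumes t: "t \<ge> a"
  shows "8 * (\<rho> t * cos (\<alpha> t)) * (\<rho> t * sin (\<alpha> t)) * \<rho> t \<le> exp h"
proof -
  have R: "r t > 0" and S: "sin (2 * \<alpha> t) > 0"
    using r_pos sin_double_pos t by auto
  have "ln (\<rho> t ^ 3 * (4 * sin (2 * \<alpha> t))) = 3 * ln (\<rho> t) + ln (4 * sin (2 * \<alpha> t))"
    using \<rho>_pos[OF t] S by (simp add: ln_mult ln_realpow)
  also have "ln (\<rho> t) = ln (r t) - 1 / (r t)\<^sup>2"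
    using R by (simp add: \<rho>_def ln_mult)
  also have "3 * (ln (r t) - 1 / (r t)\<^sup>2) + ln (4 * sin (2 * \<alpha> t)) \<le> h"
    using K_nonneg[OF t] by (simp add: K_def)
  finally have "exp (ln (\<rho> t ^ 3 * (4 * sin (2 * \<alpha> t)))) \<le> exp h"
    by simp
  then have "\<rho> t ^ 3 * (4 * sin (2 * \<alpha> t)) \<le> exp h"
    using \<rho>_pos[OF t] S by (subst (asm) exp_ln) auto
  then show ?thesis
    unfolding sin_double by (simp add: eval_nat_numeral mult_ac)
qed

lemma \<rho>_bounded_if_energy_positive:
  assumes Ka: "K a > 0"
  shows "\<exists>b\<ge>a. \<exists>B. \<forall>t\<ge>b. \<rho> t \<le> B"
proof -
  have K: "K t > 0" if "t \<ge> a" for t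
    using K_deriv continuous_on_K_rate K_nonneg Ka that by (rule linear_ode_stays_positive)
  have "(\<exists>b\<ge>a. \<exists>B. \<forall>t\<ge>b. \<rho> t * cos (\<alpha> t) + \<rho> t * sin (\<alpha> t) \<le> B) \<or>
    (\<exists>m>0. \<forall>t\<ge>a. m \<le> \<rho> t * cos (\<alpha> t) * (\<rho> t * sin (\<alpha> t)))"
  proof (rule bounded_or_away_from_axes[OF q1_deriv q2_deriv time_rate_nonneg])
    show "sqrt (K t') * cos (\<psi> t') \<le> sqrt (K t) * cos (\<psi> t)" if "a \<le> t" "t \<le> t'" for t t'
      by (rule nonincreasing_from[where a = a, OF p1_deriv])
        (use K K_nonneg cos_pos that in
          \<open>auto intro!: mult_nonneg_nonneg add_nonneg_nonneg simp: less_imp_le\<close>)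
    show "sqrt (K t') * sin (\<psi> t') \<le> sqrt (K t) * sin (\<psi> t)" if "a \<le> t" "t \<le> t'" for t t'
      by (rule nonincreasing_from[where a = a, OF p2_deriv])
        (use K K_nonneg sin_pos that in
          \<open>auto intro!: mult_nonneg_nonneg add_nonneg_nonneg simp: less_imp_le\<close>)
  qed (use \<rho>_pos sin_pos cos_pos in auto)
  then show ?thesis
  proof (elim disjE exE conjE)
    fix b B assume b: "b \<ge> a" and B: "\<forall>t\<ge>b. \<rho> t * cos (\<alpha> t) + \<rho> t * sin (\<alpha> t) \<le> B"
    have "\<rho> t \<le> B" if "t \<ge> b" for t
    proof -
      have t: "t \<ge> a"
        using that b by simp
      have "1 = (cos (\<alpha> t))\<^sup>2 + (sin (\<alpha> t))\<^sup>2"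
        by simp
      also have "\<dots> \<le> cos (\<alpha> t) + sin (\<alpha> t)"
        using sin_pos[OF t] cos_pos[OF t]
        by (intro add_mono) (auto simp: power2_eq_square mult_left_le)
      finally have "\<rho> t * 1 \<le> \<rho> t * (cos (\<alpha> t) + sin (\<alpha> t))"
        using \<rho>_pos[OF t] by (intro mult_left_mono) auto
      then show ?thesis
        using B that by (force simp: algebra_simps)
    qed
    then show ?thesis
      using b by blast
  next
    fix m :: real assume m: "m > 0" "\<forall>t\<ge>a. m \<le> \<rho> t * cos (\<alpha> t) * (\<rho> t * sin (\<alpha> t))"
    have "\<rho> t \<le> exp h / (8 * m)" if t: "t \<ge> a" for t
    proof -
      have "8 * m * \<rho> t \<le> 8 * (\<rho> t * cos (\<alpha> t) * (\<rho> t * sin (\<alpha> t))) * \<rho> t"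
        using m t \<rho>_pos[OF t] by (intro mult_right_mono mult_left_mono) auto
      also have "\<dots> \<le> exp h"
        using energy_bound[OF t] by (simp add: mult_ac)
      finally show ?thesis
        using m by (simp add: pos_le_divide_eq mult_ac)
    qed
    then show ?thesis
      by blast
  qed
qed

lemma r_bounded_if_\<rho>_bounded:
  assumes t: "t \<ge> a" and "\<rho> t \<le> B"
  shows "r t \<le> max 1 (B * exp 1)"
proof (cases "r t \<le> 1")
  case False
  have "r t = \<rho> t * exp (1 / (r t)\<^sup>2)"
    by (simp add: \<rho>_def flip: exp_add)
  also have "\<dots> \<le> B * exp 1"
    using False assms \<rho>_pos[OF t] by (intro mult_mono) (auto simp: divide_simps)
  finally show ?thesis
    by simp
qed simp

end

section \<open>Absence of unbounded orbits\<close>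

lemma (in collisionless_orbit) not_filterlim_at_top: "\<not> filterlim r at_top at_top"
proof
  assume lim: "filterlim r at_top at_top"
  show False
  proof (cases "\<exists>c\<ge>a. K c > 0")
    case True
    then obtain c where c: "c \<ge> a" "K c > 0"
      by blast
    interpret tail: collisionless_orbit h r \<alpha> \<psi> c
      by unfold_locales
        (use c r_pos \<alpha>_gt \<alpha>_lt E_nonneg r_deriv \<alpha>_deriv \<psi>_deriv in \<open>auto dest: order_trans\<close>)
    obtain b B where b: "b \<ge> c" "\<forall>t\<ge>b. \<rho> t \<le> B"
      using tail.\<rho>_bounded_if_energy_positive c by blast
    have "eventually (\<lambda>t. r t > max 1 (B * exp 1) \<and> t \<ge> b) at_top"
      using lim by (intro eventually_conj eventually_ge_at_top)
        (blast intro: filterlim_at_top_dense[THEN iffD1, rule_format])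
    then obtain t where "r t > max 1 (B * exp 1)" "t \<ge> b"
      using eventually_happens'[OF trivial_limit_at_top_linorder] by blast
    then show False
      using r_bounded_if_\<rho>_bounded[of t B] b c by force
  next
    case False
    then have K: "K t = 0" if "t \<ge> a" for t
      using K_nonneg[OF that] that by force
    have "r t \<le> r a" if "t \<ge> a" for t
      by (rule nonincreasing_from[where a = a, OF r_deriv_K]) (use K that in auto)
    moreover have "eventually (\<lambda>t. r t > r a \<and> t \<ge> a) at_top"
      using lim by (intro eventually_conj eventually_ge_at_top)
        (blast intro: filterlim_at_top_dense[THEN iffD1, rule_format])
    then obtain t where "r t > r a" "t \<ge> a"
      using eventually_happens'[OF trivial_limit_at_top_linorder] by blast
    ultimately show False
      by force
  qed
qed

theorem theorem5p2:
  fixes h :: real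
  shows "\<not> (\<exists>I r \<alpha> \<psi>. is_solution h I r \<alpha> \<psi> \<and> unbounded_solution I r \<and> collisionless I r \<alpha>)"
proof
  assume "\<exists>I r \<alpha> \<psi>. is_solution h I r \<alpha> \<psi> \<and> unbounded_solution I r \<and> collisionless I r \<alpha>"
  then obtain I r \<alpha> \<psi> where sol: "is_solution h I r \<alpha> \<psi>"
    and unb: "unbounded_solution I r" and coll: "collisionless I r \<alpha>"
    by blast
  from unb obtain a where a: "{a..} \<subseteq> I"
    by (auto simp: unbounded_solution_def)
  \<comment> \<open>After time \<open>a\<close> one is in the interior of \<open>I\<close>, where one-sided derivatives are two-sided.\<close>
  have I: "at t within I = at t" if "t \<ge> a + 1" for t
  proof (rule at_within_interior)
    have "{a<..} \<subseteq> interior I"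
      using a by (intro interior_maximal) auto
    then show "t \<in> interior I"
      using that by auto
  qed
  have mem: "t \<in> I" if "t \<ge> a + 1" for t
    using a that by auto
  interpret collisionless_orbit h r \<alpha> \<psi> "a + 1"
  proof
    fix t assume t: "t \<ge> a + 1"
    show "r t > 0" "\<alpha> t > 0" "\<alpha> t < pi / 2"
      using coll mem[OF t] by (auto simp: collisionless_def)
    show "E_hat h (r t) (\<alpha> t) \<ge> 0"
      using sol mem[OF t] by (auto simp: is_solution_def phase_space_def)
    show "(r has_real_derivative r_field h (r t) (\<alpha> t) (\<psi> t)) (at t)"
      "(\<alpha> has_real_derivative \<alpha>_field h (r t) (\<alpha> t) (\<psi> t)) (at t)"
      "(\<psi> has_real_derivative \<psi>_field (r t) (\<alpha> t) (\<psi> t)) (at t)"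
      using sol mem[OF t] I[OF t] by (auto simp: is_solution_def)
  qed
  show False
    using not_filterlim_at_top unb by (simp add: unbounded_solution_def)
qed

end
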